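(* Let $A,C\in\mathrm{Mat}_N(\mathbb C)$ and let a constraint on unitaries $U\in U(N)$ be given. Suppose that the constraint can be fulfilled by restricting the full unitary group $U(N)$ to a compact and connected subgroup $\mathbf K\subseteq U(N)$, i.e. that the set of $U\in U(N)$ satisfying the constraint is $\mathbf K$. Then the constrained $C$-numerical range $W(C,A)|_{\rm constraint}$ is a connected set in the complex plane. Moreover, in this case $W(C,A)|_{\rm constraint}$ is identical to the relative $C$-numerical range $W_{\mathbf K}(C,A)$, and hence the constrained optimisation problem is solved within it, e.g. the maximum of $|\operatorname{tr}(UAU^\dagger C^\dagger)|$ over all $U\in U(N)$ satisfying the constraint is the relative $C$-numerical radius $r_{\mathbf K}(C,A)$.
   Context: The constrained $C$-numerical range of $A$ is $W(C,A)|_{\rm constraint}:=\{\operatorname{tr}(UAU^\dagger C^\dagger) : U\in U(N),\ U \text{ satisfies the constraint}\}$. For a compact connected subgroup $\mathbf K\subseteq U(N)$, the relative $C$-numerical range is $W_{\mathbf K}(C,A):=\{\operatorname{tr}(C^\dagger KAK^\dagger) : K\in\mathbf K\}$ and the relative $C$-numerical radius is $r_{\mathbf K}(C,A):=\max_{K\in\mathbf K}|\operatorname{tr}(C^\dagger KAK^\dagger)|$. *)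

theory Defs
  imports "HOL-Analysis.Analysis" "HOL-Algebra.Group"
begin

definition conj_transpose :: "complex^'n^'m \<Rightarrow> complex^'m^'n"
  where "conj_transpose A = (\<chi> i j. cnj (A $ j $ i))"

definition unitary_matrix :: "complex^'n^'n \<Rightarrow> bool"
  where "unitary_matrix U \<longleftrightarrow>
    U ** conj_transpose U = mat 1 \<and> conj_transpose U ** U = mat 1"

definition unitary_group :: "(complex^'n^'n) monoid"
  where "unitary_group = \<lparr>carrier = {U. unitary_matrix U}, mult = (**), one = mat 1\<rparr>"

definition constrained_C_numerical_range ::
    "complex^'n^'n \<Rightarrow> complex^'n^'n \<Rightarrow> (complex^'n^'n \<Rightarrow> bool) \<Rightarrow> complex set"
  where "constrained_C_numerical_range C A P =
    {trace (U ** A ** conj_transpose U ** conj_transpose C) | U.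
       U \<in> carrier unitary_group \<and> P U}"

definition relative_C_numerical_range ::
    "(complex^'n^'n) set \<Rightarrow> complex^'n^'n \<Rightarrow> complex^'n^'n \<Rightarrow> complex set"
  where "relative_C_numerical_range \<K> C A =
    {trace (conj_transpose C ** K ** A ** conj_transpose K) | K. K \<in> \<K>}"

text \<open>
  \<^const>\<open>Greatest\<close> renders ``max'' literally; the set of values is in general infinite, so
  \<^const>\<open>Max\<close> is not applicable. As usual for a definite description, the value is only
  meaningful when the maximum is attained.
\<close>
definition relative_C_numerical_radius ::
    "(complex^'n^'n) set \<Rightarrow> complex^'n^'n \<Rightarrow> complex^'n^'n \<Rightarrow> real"
  where "relative_C_numerical_radius \<K> C A =
    (GREATEST r. \<exists>K\<in>\<K>. r = cmod (trace (conj_transpose C ** K ** A ** conj_transpose K)))"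

lemma conj_transpose_mult:
  "conj_transpose (A ** B) = conj_transpose B ** conj_transpose A"
  by (simp add: conj_transpose_def matrix_matrix_mult_def vec_eq_iff mult.commute)

lemma conj_transpose_conj_transpose: "conj_transpose (conj_transpose A) = A"
  by (simp add: conj_transpose_def vec_eq_iff)

lemma conj_transpose_mat_1: "conj_transpose (mat 1) = mat 1"
  by (auto simp: conj_transpose_def mat_def vec_eq_iff)

lemma unitary_matrix_mult:
  assumes "unitary_matrix U" "unitary_matrix V"
  shows "unitary_matrix (U ** V)"
proof -
  have "U ** V ** (conj_transpose V ** conj_transpose U)
      = U ** (V ** conj_transpose V) ** conj_transpose U"
    by (simp add: matrix_mul_assoc)
  moreover have "conj_transpose V ** conj_transpose U ** (U ** V)
      = conj_transpose V ** (conj_transpose U ** U) ** V"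
    by (simp add: matrix_mul_assoc)
  ultimately show ?thesis
    using assms by (simp add: unitary_matrix_def conj_transpose_mult)
qed

lemma group_unitary_group: "group (unitary_group :: (complex^'n^'n) monoid)"
proof (rule groupI)
  fix U :: "complex^'n^'n"
  assume "U \<in> carrier unitary_group"
  then show "\<exists>V\<in>carrier unitary_group. V \<otimes>\<^bsub>unitary_group\<^esub> U = \<one>\<^bsub>unitary_group\<^esub>"
    by (intro bexI[of _ "conj_transpose U"])
       (auto simp: unitary_group_def unitary_matrix_def conj_transpose_conj_transpose)
qed (auto simp: unitary_group_def unitary_matrix_mult matrix_mul_assoc
       unitary_matrix_def[of "mat 1"] conj_transpose_mat_1)

lemma inv_unitary_group:
  assumes "unitary_matrix U"
  shows "inv\<^bsub>unitary_group\<^esub> U = conj_transpose U"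
  using assms
  by (intro group.inv_equality[OF group_unitary_group])
     (auto simp: unitary_group_def unitary_matrix_def conj_transpose_conj_transpose)

end

theory Submission
  imports Defs
begin

lemma trace_conj_orbit_rotate:
  "trace (U ** A ** conj_transpose U ** D) = trace (D ** U ** A ** conj_transpose U)"
  by (simp add: trace_mul_sym[of _ D] matrix_mul_assoc)

text \<open>Once unfolded, the trace is a finite sum of products of constants, entries of
  \<open>U\<close> and conjugates of such entries.\<close>

lemma continuous_on_trace_conj_orbit:
  "continuous_on S (\<lambda>U :: complex^'n^'n. trace (D ** U ** A ** conj_transpose U))"
  unfolding trace_def matrix_matrix_mult_def conj_transpose_def
  by (simp, intro continuous_intros)

text \<open>\<open>GREATEST\<close> says something only about an attained maximum. The extreme value
  theorem supplies one on a nonempty compact set; the two conclusions together characterise the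
  radius as that maximum.\<close>

lemma
  assumes "compact \<K>" "\<K> \<noteq> {}"
  shows relative_C_numerical_radius_attained:
      "\<exists>K\<in>\<K>. cmod (trace (conj_transpose C ** K ** A ** conj_transpose K))
         = relative_C_numerical_radius \<K> C A"
    and relative_C_numerical_radius_upper:
      "\<And>K. K \<in> \<K> \<Longrightarrow> cmod (trace (conj_transpose C ** K ** A ** conj_transpose K))
         \<le> relative_C_numerical_radius \<K> C A"
proof -
  let ?f = "\<lambda>K. cmod (trace (conj_transpose C ** K ** A ** conj_transpose K))"
  have "continuous_on \<K> ?f"
    by (intro continuous_on_norm continuous_on_trace_conj_orbit)
  then obtain M where M: "M \<in> \<K>" "\<And>K. K \<in> \<K> \<Longrightarrow> ?f K \<le> ?f M"
    using continuous_attains_sup[OF assms] by blast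
  \<comment> \<open>The value at the maximiser \<open>M\<close> belongs to the set of values and
    bounds it, which determines \<open>GREATEST\<close>.\<close>
  then have radius: "relative_C_numerical_radius \<K> C A = ?f M"
    unfolding relative_C_numerical_radius_def by (intro Greatest_equality) auto
  show "\<exists>K\<in>\<K>. ?f K = relative_C_numerical_radius \<K> C A"
    using M(1) radius by auto
  show "?f K \<le> relative_C_numerical_radius \<K> C A" if "K \<in> \<K>" for K
    using M(2)[OF that] radius by simp
qed

text \<open>The range is the continuous image of \<open>\<K>\<close>; the simplification only
  matches the set comprehension with that image.\<close>

lemma connected_relative_C_numerical_range:
  assumes "connected \<K>"
  shows "connected (relative_C_numerical_range \<K> C A)"
  using connected_continuous_image[OF continuous_on_trace_conj_orbit assms]
  by (simp add: relative_C_numerical_range_def image_def Bex_def conj_commute)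

lemma constrained_eq_relative_C_numerical_range:
  assumes "{U \<in> carrier unitary_group. P U} = \<K>"
  shows "constrained_C_numerical_range C A P = relative_C_numerical_range \<K> C A"
  using assms
  by (auto simp: constrained_C_numerical_range_def relative_C_numerical_range_def
      trace_conj_orbit_rotate)

theorem corollary3p2:
  fixes A C :: "complex^'n^'n"
    and P :: "complex^'n^'n \<Rightarrow> bool"
    and \<K> :: "(complex^'n^'n) set"
  assumes "subgroup \<K> unitary_group"
    and "compact \<K>"
    and "connected \<K>"
    and "{U \<in> carrier unitary_group. P U} = \<K>"
  shows "connected (constrained_C_numerical_range C A P)
    \<and> constrained_C_numerical_range C A P = relative_C_numerical_range \<K> C A
    \<and> (\<exists>U\<in>carrier unitary_group. P U
         \<and> cmod (trace (U ** A ** conj_transpose U ** conj_transpose C))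
             = relative_C_numerical_radius \<K> C A)
    \<and> (\<forall>U\<in>carrier unitary_group. P U \<longrightarrow>
         cmod (trace (U ** A ** conj_transpose U ** conj_transpose C))
             \<le> relative_C_numerical_radius \<K> C A)"
proof -
  \<comment> \<open>A subgroup contains the identity, so the extreme value argument applies.\<close>
  have "\<K> \<noteq> {}"
    using subgroup.one_closed[OF assms(1)] by auto
  note attained = relative_C_numerical_radius_attained[OF assms(2) this, of C A]
    and upper = relative_C_numerical_radius_upper[OF assms(2) this, of _ C A]
  have mem: "U \<in> \<K> \<longleftrightarrow> U \<in> carrier unitary_group \<and> P U" for U
    using assms(4) by auto
  show ?thesis
    \<comment> \<open>Rotating the traces in the two maximum clauses brings them to the form in
      which the radius is defined; \<open>mem\<close> then exchanges the constraint for membership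
      in \<open>\<K>\<close>.\<close>
    unfolding constrained_eq_relative_C_numerical_range[OF assms(4)] trace_conj_orbit_rotate
    using connected_relative_C_numerical_range[OF assms(3)] attained upper
    by (auto simp: mem)
qed

end
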